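(* Let $(\mathcal S,\mathcal A,\lambda)$ be the mixture measure space of a finite or countable family of disjoint $\sigma$-finite measure spaces $(\mathcal S_i,\mathcal A_i,\lambda_i)_{i\in\mathcal D}$ and let $\pi$ be a probability measure on $(\mathcal S,\mathcal A)$ with density $p$ w.r.t. $\lambda$. Let $\mathcal M$ be a finite or countable set of post-hoc moves: each move $\ell\in\mathcal M$, transitioning from $\mathcal S_j$ to $\mathcal S_i$ (both depending on $\ell$), has a unique backward move $r_\ell\in\mathcal M$ transitioning from $\mathcal S_i$ to $\mathcal S_j$, a $\sigma$-finite measure space $(\mathcal U_\ell,\mathcal B_\ell,\nu_\ell)$, a kernel density $k_\ell$ from $(\mathcal S_j,\mathcal A_j)$ to $(\mathcal U_\ell,\mathcal B_\ell,\nu_\ell)$ and a measurable function $\mathbf s_\ell:\mathcal S_j\times\mathcal U_\ell\to\mathcal S_i$. Assume that for each move $\ell\in\mathcal M$ there exist measurable functions $\mathbf u_\ell:\mathcal S_j\times\mathcal U_\ell\to\mathcal U_{r_\ell}$ and $f_\ell:\mathcal S_j\times\mathcal U_\ell\to\mathbb R_{\ge0}$ such that, with $(\mathbf s,\mathbf u)_\ell=(\mathbf s_\ell,\mathbf u_\ell)$, (I) $(\mathbf s,\mathbf u)_\ell=(\mathbf s,\mathbf u)_{r_\ell}^{-1}$; (II) $\lambda_i\otimes\nu_{r_\ell}\big((\mathbf s,\mathbf u)_\ell(ds',du')\big)=f_\ell(s',u')\,\lambda_j\otimes\nu_\ell(ds',du')$. Define the proposal of move $\ell$ by $K_\ell(s',\cdot)=\int\delta_{\mathbf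 s_\ell(s',u')}(\cdot)\,k_\ell(s',u')\,\nu_\ell(du')$, and $$\mathtt r^\ell_{s'u'}=\frac{p(\mathbf s_\ell(s',u'))\,k_{r_\ell}\big((\mathbf s,\mathbf u)_\ell(s',u')\big)}{p(s')\,k_\ell(s',u')}\cdot f_\ell(s',u').$$ Then, for a move $\ell$ with transitions from $s'\in\mathcal S_j$ to $s\in\mathcal S_i$, $$\frac{\pi\otimes K_{r_\ell}(ds,ds')}{\pi\otimes K_\ell(ds',ds)}=\mathbb E\big\{\mathtt r^\ell_{s'U}\ \big|\ \mathbf s_\ell(s',U)=s\big\},$$ where $U$ is a random variable distributed according to $k_\ell(s',u')\,\nu_\ell(du')$.
   Context: Mixture measure space: $\mathcal D$ is a finite or countable set, $(\mathcal S_i,\mathcal A_i,\lambda_i)_{i\in\mathcal D}$ are $\sigma$-finite measure spaces with pairwise disjoint $\mathcal S_i$; $\mathcal S=\bigcup_{i}\mathcal S_i$, $\mathcal A=\sigma(\bigcup_i\mathcal A_i)$, $\lambda=\sum_{i}\lambda_i\circ\mathrm{id}_i^{-1}$, where $\mathrm{id}_i:\mathcal S_i\to\mathcal S$ is the inclusion. A kernel density from $(E,\mathcal E)$ to $(F,\mathcal F,\rho)$ is a jointly measurable $k:E\times F\to[0,\infty)$ with $\int k(x,y)\rho(dy)=1$ for all $x\in E$. Condition (II) means $\lambda_i\otimes\nu_{r_\ell}\big((\mathbf s,\mathbf u)_\ell(C)\big)=\int_C f_\ell\,d(\lambda_j\otimes\nu_\ell)$ for all $C\in\mathcal A_j\otimes\mathcal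 B_\ell$. Notation: $\pi\otimes K_\ell(A\times B)=\int_A K_\ell(s',B)\,\pi(ds')$ for $A\in\mathcal A_j$, $B\in\mathcal A_i$, and $\pi\otimes K_{r_\ell}(B\times A)=\int_B K_{r_\ell}(s,A)\,\pi(ds)$. The left-hand side of the conclusion denotes the density, evaluated at $(s',s)\in\mathcal S_j\times\mathcal S_i$, of the transposed measure $A\times B\mapsto\pi\otimes K_{r_\ell}(B\times A)$ with respect to $\pi\otimes K_\ell$. Such a density need not exist everywhere: it exists on the set of those $(s',s)$ at which both measures have a positive density with respect to a common dominating measure, where it is the quotient of these two densities. Convention: densities are implicitly set to $0$ wherever they are not defined.
   Formalization: Added: backward transitions with positive p·k_{r_ℓ} whose reversal has k_ℓ = 0 must land in a π⊗K_ℓ-null set (the claim fails otherwise); equality is a.e. jointly in (s',s), and for π-a.e. fixed s' when 𝒜_i is countably generated. *)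

theory Defs
  imports "HOL-Probability.Probability"
begin

definition mixture :: "'d set \<Rightarrow> ('d \<Rightarrow> 's measure) \<Rightarrow> 's measure" where
  "mixture D S = measure_of (\<Union>i\<in>D. space (S i)) (\<Union>i\<in>D. sets (S i))
     (\<lambda>A. \<integral>\<^sup>+ i. emeasure (S i) (A \<inter> space (S i)) \<partial>count_space D)"

definition kernel_density :: "'a measure \<Rightarrow> 'b measure \<Rightarrow> ('a \<times> 'b \<Rightarrow> real) \<Rightarrow> bool" where
  "kernel_density E F k \<longleftrightarrow>
     k \<in> borel_measurable (E \<Otimes>\<^sub>M F) \<and>
     (\<forall>z\<in>space (E \<Otimes>\<^sub>M F). 0 \<le> k z) \<and>
     (\<forall>x\<in>space E. (\<integral>\<^sup>+ y. ennreal (k (x, y)) \<partial>F) = 1)"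

text \<open>The measure that sends \<open>A \<times> B\<close> to the integral of \<open>K x B\<close> over \<open>x \<in> A\<close> with respect
  to \<open>M\<close>, for a kernel \<open>K\<close> from \<open>M\<close> to \<open>N\<close>.\<close>

definition kernel_prod :: "'a measure \<Rightarrow> 'b measure \<Rightarrow> ('a \<Rightarrow> 'b measure) \<Rightarrow> ('a \<times> 'b) measure" where
  "kernel_prod M N K = measure_of (space M \<times> space N)
     {A \<times> B |A B. A \<in> sets M \<and> B \<in> sets N}
     (\<lambda>X. \<integral>\<^sup>+ x. (\<integral>\<^sup>+ y. indicator X (x, y) \<partial>K x) \<partial>M)"

text \<open>The law of \<open>t (x, U)\<close> when \<open>U\<close> has density \<open>k (x, \<cdot>)\<close> with respect to \<open>N\<close>, that is, the
  integral of the point masses at \<open>t (x, u)\<close> against \<open>k (x, u) N(du)\<close>.\<close>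

definition proposal ::
  "'b measure \<Rightarrow> 'c measure \<Rightarrow> ('a \<times> 'b \<Rightarrow> real) \<Rightarrow> ('a \<times> 'b \<Rightarrow> 'c) \<Rightarrow> 'a \<Rightarrow> 'c measure" where
  "proposal N F k t x = distr (density N (\<lambda>u. ennreal (k (x, u)))) F (\<lambda>u. t (x, u))"

text \<open>Here \<open>q\<close> is (a version of) the density of \<open>P\<close> with respect to \<open>Q\<close>: the quotient of their
  densities with respect to some dominating measure \<open>R\<close> where both are positive, and \<open>0\<close>
  elsewhere.  Absolute continuity of \<open>P\<close> with respect to \<open>Q\<close> is not required.\<close>

definition is_density_quotient :: "'a measure \<Rightarrow> 'a measure \<Rightarrow> ('a \<Rightarrow> ennreal) \<Rightarrow> bool" where
  "is_density_quotient P Q q \<longleftrightarrow>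
     (\<exists>R g h. g \<in> borel_measurable R \<and> h \<in> borel_measurable R \<and>
        P = density R g \<and> Q = density R h \<and>
        q = (\<lambda>z. if 0 < g z \<and> 0 < h z then g z / h z else 0))"

text \<open>Here \<open>h\<close> is a version of \<open>y \<mapsto> E(X | Y = y)\<close> under \<open>P\<close>, with \<open>Y\<close> taking values in \<open>N\<close>.  A
  finite measure \<open>P\<close> that is not normalised has the same conditional expectations as its
  normalisation.\<close>

definition is_cond_exp_given ::
  "'a measure \<Rightarrow> ('a \<Rightarrow> ennreal) \<Rightarrow> 'b measure \<Rightarrow> ('a \<Rightarrow> 'b) \<Rightarrow> ('b \<Rightarrow> ennreal) \<Rightarrow> bool" where
  "is_cond_exp_given P X N Y h \<longleftrightarrow>
     h \<in> borel_measurable N \<and>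
     (AE w in P. h (Y w) = nn_cond_exp P (vimage_algebra (space P) Y N) X w)"

definition countably_generated_measure :: "'a measure \<Rightarrow> bool" where
  "countably_generated_measure N \<longleftrightarrow>
     (\<exists>G. countable G \<and> G \<subseteq> Pow (space N) \<and> sets N = sigma_sets (space N) G)"

text \<open>The ratio is \<open>0\<close> where its denominator vanishes, because \<open>x / 0 = 0\<close>.\<close>

definition move_ratio ::
  "('s \<Rightarrow> real) \<Rightarrow> ('s \<times> 'u \<Rightarrow> real) \<Rightarrow> ('s \<times> 'u \<Rightarrow> real) \<Rightarrow> ('s \<times> 'u \<Rightarrow> 's \<times> 'u) \<Rightarrow>
   ('s \<times> 'u \<Rightarrow> real) \<Rightarrow> 's \<times> 'u \<Rightarrow> real" where
  "move_ratio p k kr \<Phi> f z = p (fst (\<Phi> z)) * kr (\<Phi> z) / (p (fst z) * k z) * f z"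


lemma space_mixture: "space (mixture D S) = (\<Union>i\<in>D. space (S i))"
  unfolding mixture_def by (rule space_measure_of) (use sets.space_closed in blast)

lemma sets_mixture:
  "sets (mixture D S) = sigma_sets (\<Union>i\<in>D. space (S i)) (\<Union>i\<in>D. sets (S i))"
  unfolding mixture_def by (rule sets_measure_of) (use sets.space_closed in blast)

lemma sets_mixture_Int_space:
  assumes "disjoint_family_on (\<lambda>i. space (S i)) D" "i \<in> D" "A \<in> sets (mixture D S)"
  shows "A \<inter> space (S i) \<in> sets (S i)"
  using assms(3) unfolding sets_mixture
proof (induction rule: sigma_sets.induct)
  case (Basic a)
  then obtain j where j: "j \<in> D" "a \<in> sets (S j)" by blast
  show ?case
  proof (cases "j = i")
    case False
    then have "a \<inter> space (S i) = {}"
      using disjoint_family_onD[OF assms(1) j(1) assms(2)] sets.sets_into_space[OF j(2)] by blast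
    then show ?thesis by simp
  qed (use j in auto)
next
  case (Compl a)
  have "((\<Union>i\<in>D. space (S i)) - a) \<inter> space (S i) = space (S i) - (a \<inter> space (S i))"
    using assms(2) by blast
  then show ?case using Compl by auto
next
  case (Union a)
  have "(\<Union> (range a)) \<inter> space (S i) = (\<Union>n. a n \<inter> space (S i))" by blast
  moreover have "(\<Union>n. a n \<inter> space (S i)) \<in> sets (S i)"
    using Union.IH by (intro sets.countable_UN) blast
  ultimately show ?case by simp
qed simp

lemma emeasure_mixture:
  assumes "disjoint_family_on (\<lambda>i. space (S i)) D" "A \<in> sets (mixture D S)"
  shows "emeasure (mixture D S) A = (\<integral>\<^sup>+ i. emeasure (S i) (A \<inter> space (S i)) \<partial>count_space D)"
proof (rule emeasure_measure_of[OF mixture_def _ _ _ assms(2)])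
  show "(\<Union>i\<in>D. sets (S i)) \<subseteq> Pow (\<Union>i\<in>D. space (S i))"
    using sets.space_closed by blast
  show "positive (sets (mixture D S))
     (\<lambda>A. \<integral>\<^sup>+ i. emeasure (S i) (A \<inter> space (S i)) \<partial>count_space D)"
    by (simp add: positive_def)
  show "countably_additive (sets (mixture D S))
     (\<lambda>A. \<integral>\<^sup>+ i. emeasure (S i) (A \<inter> space (S i)) \<partial>count_space D)"
  proof (rule countably_additiveI)
    fix A :: "nat \<Rightarrow> _ set"
    assume A: "range A \<subseteq> sets (mixture D S)" "disjoint_family A"
    have "(\<Sum>n. \<integral>\<^sup>+ i. emeasure (S i) (A n \<inter> space (S i)) \<partial>count_space D)
        = (\<integral>\<^sup>+ i. (\<Sum>n. emeasure (S i) (A n \<inter> space (S i))) \<partial>count_space D)"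
      by (rule nn_integral_suminf[symmetric]) simp
    also have "\<dots> = (\<integral>\<^sup>+ i. emeasure (S i) (\<Union> (range A) \<inter> space (S i)) \<partial>count_space D)"
    proof (rule nn_integral_cong)
      fix i assume "i \<in> space (count_space D)"
      then have i: "i \<in> D" by simp
      have "range (\<lambda>n. A n \<inter> space (S i)) \<subseteq> sets (S i)"
        using A(1) sets_mixture_Int_space[OF assms(1) i] by blast
      moreover have "disjoint_family (\<lambda>n. A n \<inter> space (S i))"
        using A(2) unfolding disjoint_family_on_def by blast
      ultimately have "(\<Sum>n. emeasure (S i) (A n \<inter> space (S i)))
          = emeasure (S i) (\<Union>n. A n \<inter> space (S i))"
        by (rule suminf_emeasure)
      then show "(\<Sum>n. emeasure (S i) (A n \<inter> space (S i)))
          = emeasure (S i) (\<Union> (range A) \<inter> space (S i))"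
        by simp
    qed
    finally show "(\<Sum>n. \<integral>\<^sup>+ i. emeasure (S i) (A n \<inter> space (S i)) \<partial>count_space D)
        = (\<integral>\<^sup>+ i. emeasure (S i) (\<Union> (range A) \<inter> space (S i)) \<partial>count_space D)" .
  qed
qed

lemma sets_kernel_prod: "sets (kernel_prod M N K) = sets (M \<Otimes>\<^sub>M N)"
  unfolding kernel_prod_def sets_pair_measure
  by (rule sets_measure_of) (use sets.space_closed[of M] sets.space_closed[of N] in blast)

lemma emeasure_kernel_prod:
  assumes K: "K \<in> measurable M (subprob_algebra N)" and X: "X \<in> sets (M \<Otimes>\<^sub>M N)"
  shows "emeasure (kernel_prod M N K) X = (\<integral>\<^sup>+ x. (\<integral>\<^sup>+ y. indicator X (x, y) \<partial>K x) \<partial>M)"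
proof (rule emeasure_measure_of[OF kernel_prod_def])
  show "{A \<times> B |A B. A \<in> sets M \<and> B \<in> sets N} \<subseteq> Pow (space M \<times> space N)"
    using sets.space_closed[of M] sets.space_closed[of N] by blast
  show "X \<in> sets (kernel_prod M N K)" using X by (simp add: sets_kernel_prod)
  show "positive (sets (kernel_prod M N K))
     (\<lambda>X. \<integral>\<^sup>+ x. (\<integral>\<^sup>+ y. indicator X (x, y) \<partial>K x) \<partial>M)"
    by (simp add: positive_def)
  show "countably_additive (sets (kernel_prod M N K))
     (\<lambda>X. \<integral>\<^sup>+ x. (\<integral>\<^sup>+ y. indicator X (x, y) \<partial>K x) \<partial>M)"
  proof (rule countably_additiveI)
    fix A :: "nat \<Rightarrow> _ set"
    assume A: "range A \<subseteq> sets (kernel_prod M N K)" "disjoint_family A"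
    have Am [measurable]: "A n \<in> sets (M \<Otimes>\<^sub>M N)" for n
      using A(1) by (auto simp: sets_kernel_prod)
    have ind: "(\<Sum>n. indicator (A n) z :: ennreal) = indicator (\<Union> (range A)) z" for z
      using suminf_indicator[OF A(2), of z] by simp
    have "(\<Sum>n. \<integral>\<^sup>+ x. (\<integral>\<^sup>+ y. indicator (A n) (x, y) \<partial>K x) \<partial>M)
        = (\<integral>\<^sup>+ x. (\<Sum>n. \<integral>\<^sup>+ y. indicator (A n) (x, y) \<partial>K x) \<partial>M)"
      by (rule nn_integral_suminf[symmetric])
         (rule nn_integral_measurable_subprob_algebra2[OF _ K], simp)
    also have "\<dots> = (\<integral>\<^sup>+ x. (\<integral>\<^sup>+ y. indicator (\<Union> (range A)) (x, y) \<partial>K x) \<partial>M)"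
    proof (rule nn_integral_cong)
      fix x assume x: "x \<in> space M"
      have s: "sets (K x) = sets N" using K x by (rule sets_kernel)
      have "(\<Sum>n. \<integral>\<^sup>+ y. indicator (A n) (x, y) \<partial>K x)
          = (\<integral>\<^sup>+ y. (\<Sum>n. indicator (A n) (x, y)) \<partial>K x)"
        by (rule nn_integral_suminf[symmetric])
           (use x s in \<open>simp cong: measurable_cong_sets\<close>)
      then show "(\<Sum>n. \<integral>\<^sup>+ y. indicator (A n) (x, y) \<partial>K x)
          = (\<integral>\<^sup>+ y. indicator (\<Union> (range A)) (x, y) \<partial>K x)"
        by (simp add: ind)
    qed
    finally show "(\<Sum>n. \<integral>\<^sup>+ x. (\<integral>\<^sup>+ y. indicator (A n) (x, y) \<partial>K x) \<partial>M)
        = (\<integral>\<^sup>+ x. (\<integral>\<^sup>+ y. indicator (\<Union> (range A)) (x, y) \<partial>K x) \<partial>M)" .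
  qed
qed

lemma ex_density_quotient:
  assumes "finite_measure P" "finite_measure Q" and sPQ: "sets P = sets Q"
  shows "\<exists>q. is_density_quotient P Q q"
proof -
  interpret P: finite_measure P by fact
  interpret Q: finite_measure Q by fact
  define R where "R = measure_of (space P) (sets P) (\<lambda>A. emeasure P A + emeasure Q A)"
  have sR: "sets R = sets P"
    unfolding R_def by simp
  have eR: "emeasure R A = emeasure P A + emeasure Q A" if "A \<in> sets P" for A
  proof (rule emeasure_measure_of[OF R_def])
    show "sets P \<subseteq> Pow (space P)" by (rule sets.space_closed)
    show "A \<in> sets R" using that sR by simp
    show "positive (sets R) (\<lambda>A. emeasure P A + emeasure Q A)"
      by (simp add: positive_def)
    show "countably_additive (sets R) (\<lambda>A. emeasure P A + emeasure Q A)"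
    proof (rule countably_additiveI)
      fix A :: "nat \<Rightarrow> _ set"
      assume A: "range A \<subseteq> sets R" "disjoint_family A"
      have "(\<Sum>n. emeasure P (A n) + emeasure Q (A n))
          = (\<Sum>n. emeasure P (A n)) + (\<Sum>n. emeasure Q (A n))"
        by (rule suminf_add[symmetric]) auto
      then show "(\<Sum>n. emeasure P (A n) + emeasure Q (A n))
          = emeasure P (\<Union> (range A)) + emeasure Q (\<Union> (range A))"
        using A sR sPQ by (simp add: suminf_emeasure)
    qed
  qed
  have "space R = space P" "space Q = space P"
    using sets_eq_imp_space_eq[OF sR] sets_eq_imp_space_eq[OF sPQ] by simp_all
  then have "emeasure R (space R) = emeasure P (space P) + emeasure Q (space Q)"
    using eR[of "space P"] by simp
  then have "emeasure R (space R) \<noteq> \<infinity>"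
    using P.emeasure_finite Q.emeasure_finite by simp
  then have "finite_measure R" by (rule finite_measureI)
  then interpret R: finite_measure R .
  have "absolutely_continuous R P" "absolutely_continuous R Q"
    unfolding absolutely_continuous_def
    using sR sPQ eR by (auto simp: null_sets_def)
  then have "density R (RN_deriv R P) = P" "density R (RN_deriv R Q) = Q"
    using R.density_RN_deriv sR sPQ by auto
  then show ?thesis
    unfolding is_density_quotient_def
    by (metis borel_measurable_RN_deriv)
qed

end

theory Submission
  imports Defs
begin

text \<open>Both move measures are images, under \<open>T (x, v) = (x, s (x, v))\<close>, of measures with densities
  \<open>a = p \<cdot> k\<close> and \<open>c = f \<cdot> ((p \<cdot> k') \<circ> \<Phi>)\<close> with respect to the same measure \<open>\<lambda> \<otimes> \<nu>\<close>: conditions (I) and (II)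
  transport the backward move along the bijection \<open>\<Phi>\<close>.  On \<open>{a > 0}\<close> the ratio is \<open>c / a\<close>, and the
  density of an image measure with respect to another one is the conditional expectation of the
  density upstairs given \<open>T\<close>.  The mass of \<open>c\<close> on \<open>{a = 0}\<close> is carried by a null set of the forward
  measure, so that the density quotient ignores it.\<close>

section \<open>Density quotients of image measures and conditional expectations\<close>

text \<open>Absolute continuity may fail, so \<open>P\<close> is split along the set
  \<open>H\<close> where the density \<open>h\<close> of \<open>Q\<close> is positive. Almost
  everywhere on \<open>H\<close> the product of \<open>q\<close> and \<open>h\<close> is
  \<open>g\<close>, so \<open>q\<close> is the density with respect to \<open>Q\<close> of the part
  of \<open>P\<close> on \<open>H\<close>. Off \<open>H\<close>, where \<open>Q\<close> has no mass,
  \<open>q\<close> vanishes.\<close>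

lemma density_quotient_carrier:
  assumes q: "is_density_quotient P Q q" and P: "finite_measure P" and Q: "finite_measure Q"
  obtains H where "H \<in> sets Q" "AE y in Q. y \<in> H"
    and "\<And>B. B \<in> null_sets Q \<Longrightarrow> emeasure P (B \<inter> H) = 0"
    and "\<And>A. A \<in> sets Q \<Longrightarrow> (\<integral>\<^sup>+ y. q y * indicator A y \<partial>Q) = emeasure P (A \<inter> H)"
    and "q \<in> borel_measurable Q"
proof -
  from q obtain R g h where [measurable]: "g \<in> borel_measurable R" "h \<in> borel_measurable R"
    and PR: "P = density R g" and QR: "Q = density R h"
    and q_eq: "q = (\<lambda>z. if 0 < g z \<and> 0 < h z then g z / h z else 0)"
    unfolding is_density_quotient_def by blast
  have [measurable]: "q \<in> borel_measurable R"
    unfolding q_eq by measurable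
  define H where "H = {y \<in> space R. 0 < h y}"
  have H [measurable]: "H \<in> sets R"
    unfolding H_def by measurable
  have "(\<integral>\<^sup>+ y. h y \<partial>R) = emeasure Q (space Q)"
    unfolding QR by (subst emeasure_density) (auto intro!: nn_integral_cong)
  then have "(\<integral>\<^sup>+ y. h y \<partial>R) \<noteq> \<infinity>"
    using finite_measure.emeasure_finite[OF Q, of "space Q"] by simp
  \<comment> \<open>Finiteness of \<open>h\<close> permits cancelling it against the denominator of
    \<open>g y / h y\<close>; in the extended nonnegative reals this fails at infinity, where the
    quotient is \<open>0\<close>.\<close>
  then have h_fin: "AE y in R. h y \<noteq> \<infinity>"
    by (intro nn_integral_PInf_AE) simp_all
  show thesis
  proof (rule that)
    show "H \<in> sets Q" "q \<in> borel_measurable Q"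
      by (simp_all add: QR)
    show "AE y in Q. y \<in> H"
      unfolding QR by (subst AE_density) (auto simp: H_def)
  next
    fix B assume B: "B \<in> null_sets Q"
    then have [measurable]: "B \<in> sets R"
      by (auto simp: QR)
    have "AE y in Q. y \<notin> B"
      using B by (rule AE_not_in)
    then have "AE y in R. 0 < h y \<longrightarrow> y \<notin> B"
      unfolding QR by (subst (asm) AE_density) auto
    \<comment> \<open>On \<open>H\<close> the density of \<open>Q\<close> is positive, so a null set
      of \<open>Q\<close> meets \<open>H\<close> in a null set of the dominating measure
      \<open>R\<close>, hence of \<open>P\<close>.\<close>
    then have "AE y in R. g y * indicator (B \<inter> H) y = 0"
      by eventually_elim (auto simp: H_def split: split_indicator)
    then show "emeasure P (B \<inter> H) = 0"
      unfolding PR by (simp add: emeasure_density nn_integral_0_iff_AE)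
  next
    fix A assume "A \<in> sets Q"
    then have [measurable]: "A \<in> sets R"
      by (simp add: QR)
    have "(\<integral>\<^sup>+ y. q y * indicator A y \<partial>Q) = (\<integral>\<^sup>+ y. h y * (q y * indicator A y) \<partial>R)"
      unfolding QR by (rule nn_integral_density) simp_all
    also have "\<dots> = (\<integral>\<^sup>+ y. g y * indicator (A \<inter> H) y \<partial>R)"
    proof (rule nn_integral_cong_AE)
      show "AE y in R. h y * (q y * indicator A y) = g y * indicator (A \<inter> H) y"
        using h_fin AE_space
      proof eventually_elim
        case (elim y)
        have "h y * q y = g y * indicator H y"
        proof (cases "0 < g y \<and> 0 < h y")
          case True
          then have "h y * q y = g y * h y / h y"
            by (simp add: q_eq ennreal_times_divide mult.commute)
          also have "\<dots> = g y"
            using True elim by (intro ennreal_mult_divide_eq) auto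
          finally show ?thesis
            using True elim by (simp add: H_def)
        next
          case False
          then show ?thesis
            by (auto simp: q_eq H_def split: split_indicator)
        qed
        then show ?case
          by (auto split: split_indicator)
      qed
    qed
    also have "\<dots> = emeasure P (A \<inter> H)"
      unfolding PR by (simp add: emeasure_density)
    finally show "(\<integral>\<^sup>+ y. q y * indicator A y \<partial>Q) = emeasure P (A \<inter> H)" .
  qed
qed

text \<open>Almost every point with \<open>a z > 0\<close> is mapped into \<open>H\<close>, the
  carrier of the image of \<open>a\<close>. Almost every point with \<open>a z = 0\<close> and
  \<open>c z > 0\<close> is mapped into \<open>Z\<close>, and \<open>Z \<inter> H\<close> has no
  mass under the image of \<open>c\<close>. So restricting the image of \<open>c\<close> to
  \<open>H\<close>, which is all that \<open>q\<close> sees, amounts upstairs to dropping the mass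
  of \<open>c\<close> on the zero set of \<open>a\<close>.\<close>

lemma nn_integral_density_quotient_distr:
  fixes a c :: "'a \<Rightarrow> ennreal"
  assumes [measurable]: "a \<in> borel_measurable W" "c \<in> borel_measurable W" "T \<in> measurable W N"
    and q: "is_density_quotient (distr (density W c) N T) (distr (density W a) N T) q"
    and fin: "finite_measure (distr (density W c) N T)" "finite_measure (distr (density W a) N T)"
    and Z: "Z \<in> null_sets (distr (density W a) N T)"
    and sing: "AE z in W. 0 < c z \<and> a z = 0 \<longrightarrow> T z \<in> Z"
    and A [measurable]: "A \<in> sets N"
  shows "(\<integral>\<^sup>+ z. a z * (q (T z) * indicator A (T z)) \<partial>W)
      = (\<integral>\<^sup>+ z. (if a z = 0 then 0 else c z) * indicator A (T z) \<partial>W)"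
proof -
  obtain H where H: "H \<in> sets (distr (density W a) N T)" "AE y in distr (density W a) N T. y \<in> H"
    and HZ: "\<And>B. B \<in> null_sets (distr (density W a) N T)
        \<Longrightarrow> emeasure (distr (density W c) N T) (B \<inter> H) = 0"
    and qH: "\<And>A. A \<in> sets (distr (density W a) N T)
        \<Longrightarrow> (\<integral>\<^sup>+ y. q y * indicator A y \<partial>distr (density W a) N T)
          = emeasure (distr (density W c) N T) (A \<inter> H)"
    and qm: "q \<in> borel_measurable (distr (density W a) N T)"
    using density_quotient_carrier[OF q fin] by blast
  have [measurable]: "H \<in> sets N" "Z \<in> sets N" "q \<in> borel_measurable N"
    using H(1) Z qm by auto
  have AE_H: "AE z in W. 0 < a z \<longrightarrow> T z \<in> H"
    using H(2) by (simp add: AE_distr_iff AE_density)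
  have emeasure_c: "emeasure (distr (density W c) N T) B = (\<integral>\<^sup>+ z. c z * indicator B (T z) \<partial>W)"
    if [measurable]: "B \<in> sets N" for B
    by (subst nn_integral_indicator[symmetric], simp, subst nn_integral_distr)
       (simp_all add: nn_integral_density)
  have "AE z in W. c z * indicator (Z \<inter> H) (T z) = 0"
    using HZ[OF Z] by (simp add: emeasure_c nn_integral_0_iff_AE)
  then have AE_eq: "AE z in W. c z * indicator (A \<inter> H) (T z)
      = (if a z = 0 then 0 else c z) * indicator A (T z)"
    using AE_H sing by eventually_elim (auto simp: zero_less_iff_neq_zero split: split_indicator)
  have "(\<integral>\<^sup>+ z. a z * (q (T z) * indicator A (T z)) \<partial>W)
      = (\<integral>\<^sup>+ y. q y * indicator A y \<partial>distr (density W a) N T)"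
    by (simp add: nn_integral_distr nn_integral_density)
  also have "\<dots> = (\<integral>\<^sup>+ z. c z * indicator (A \<inter> H) (T z) \<partial>W)"
    by (simp add: qH emeasure_c)
  also have "\<dots> = (\<integral>\<^sup>+ z. (if a z = 0 then 0 else c z) * indicator A (T z) \<partial>W)"
    by (rule nn_integral_cong_AE[OF AE_eq])
  finally show ?thesis .
qed

text \<open>Every event of the sigma-algebra generated by \<open>Y\<close> is the preimage of some
  set of \<open>N\<close>, so testing on \<open>sets N\<close> suffices. Finiteness of
  \<open>P\<close> makes that subalgebra sigma-finite, the setting in which
  \<open>nn_cond_exp\<close> is characterised by its integrals.\<close>

lemma is_cond_exp_givenI:
  assumes P: "finite_measure P"
    and [measurable]: "X \<in> borel_measurable P" "Y \<in> measurable P N" "h \<in> borel_measurable N"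
    and eq: "\<And>A. A \<in> sets N \<Longrightarrow>
      (\<integral>\<^sup>+ w. X w * indicator A (Y w) \<partial>P) = (\<integral>\<^sup>+ w. h (Y w) * indicator A (Y w) \<partial>P)"
  shows "is_cond_exp_given P X N Y h"
proof -
  let ?F = "vimage_algebra (space P) Y N"
  have Y: "Y \<in> space P \<rightarrow> space N"
    using assms(3) by (rule measurable_space[THEN Pi_I])
  have "subalgebra P ?F"
    unfolding subalgebra_def sets_vimage_algebra2[OF Y] by (auto intro: measurable_sets[OF assms(3)])
  then interpret sigma_finite_subalgebra P ?F
    using P by (intro finite_measure_subalgebra_is_sigma_finite finite_measure_subalgebra.intro
        finite_measure_subalgebra_axioms.intro)
  have "AE w in P. h (Y w) = nn_cond_exp P ?F X w"
  proof (rule nn_cond_exp_charact)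
    fix B assume "B \<in> sets ?F"
    then obtain A where A: "A \<in> sets N" "B = Y -` A \<inter> space P"
      unfolding sets_vimage_algebra2[OF Y] by blast
    have "(\<integral>\<^sup>+ w\<in>B. g w \<partial>P) = (\<integral>\<^sup>+ w. g w * indicator A (Y w) \<partial>P)" for g
      unfolding A(2) by (rule nn_integral_cong) (auto split: split_indicator)
    then show "(\<integral>\<^sup>+ w\<in>B. X w \<partial>P) = (\<integral>\<^sup>+ w\<in>B. h (Y w) \<partial>P)"
      using eq[OF A(1)] by simp
  next
    show "(\<lambda>w. h (Y w)) \<in> borel_measurable ?F"
      using assms(4) measurable_vimage_algebra1[OF Y] by (rule measurable_compose[rotated])
  qed simp
  then show ?thesis
    unfolding is_cond_exp_given_def by simp
qed

section \<open>One component of the mixture space\<close>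

lemma sets_mixture_component: "i \<in> D \<Longrightarrow> A \<in> sets (S i) \<Longrightarrow> A \<in> sets (mixture D S)"
  unfolding sets_mixture by (rule sigma_sets.Basic) blast

lemma measurable_mixture_component:
  assumes "disjoint_family_on (\<lambda>i. space (S i)) D" "i \<in> D" "g \<in> measurable (mixture D S) N"
  shows "g \<in> measurable (S i) N"
proof (rule measurableI)
  show "g x \<in> space N" if "x \<in> space (S i)" for x
    using measurable_space[OF assms(3)] that assms(2) by (auto simp: space_mixture)
  fix A assume "A \<in> sets N"
  then have "(g -` A \<inter> space (mixture D S)) \<inter> space (S i) \<in> sets (S i)"
    using assms by (intro sets_mixture_Int_space[OF assms(1,2)] measurable_sets[OF assms(3)])
  moreover have "(g -` A \<inter> space (mixture D S)) \<inter> space (S i) = g -` A \<inter> space (S i)"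
    using assms(2) by (auto simp: space_mixture)
  ultimately show "g -` A \<inter> space (S i) \<in> sets (S i)" by simp
qed

text \<open>Disjointness leaves a single nonzero term in the mixture sum of a set inside
  \<open>space (S i)\<close>. Thus \<open>\<pi>\<close> restricted to a component has density
  \<open>p\<close> with respect to \<open>S i\<close> itself, and moves can be treated with the
  component measures.\<close>

lemma restrict_space_mixture:
  assumes disj: "disjoint_family_on (\<lambda>i. space (S i)) D" and i: "i \<in> D"
  shows "restrict_space (mixture D S) (space (S i)) = S i"
proof (rule measure_eqI)
  have Si: "space (S i) \<inter> space (mixture D S) \<in> sets (mixture D S)"
    by (rule sets.Int[OF sets_mixture_component[of i D, OF i sets.top] sets.top])
  have sets_iff: "A \<in> sets (restrict_space (mixture D S) (space (S i))) \<longleftrightarrow> A \<in> sets (S i)" for A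
    unfolding sets_restrict_space_iff[OF Si]
  proof
    assume A: "A \<subseteq> space (S i) \<and> A \<in> sets (mixture D S)"
    then have "A \<inter> space (S i) = A" by blast
    then show "A \<in> sets (S i)"
      using sets_mixture_Int_space[OF disj i, of A] A by simp
  next
    assume "A \<in> sets (S i)"
    then show "A \<subseteq> space (S i) \<and> A \<in> sets (mixture D S)"
      using sets_mixture_component[of i D A S] i sets.sets_into_space by blast
  qed
  then show "sets (restrict_space (mixture D S) (space (S i))) = sets (S i)"
    by blast
  fix A assume "A \<in> sets (restrict_space (mixture D S) (space (S i)))"
  then have Si_A: "A \<in> sets (S i)"
    by (simp only: sets_iff)
  then have A: "A \<in> sets (mixture D S)" "A \<subseteq> space (S i)"
    using sets_mixture_component[of i D A S] i sets.sets_into_space by blast+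
  have "A \<inter> space (S j) = {}" if "j \<in> D" "j \<notin> {i}" for j
    using disjoint_family_onD[OF disj that(1) i] that A(2) by blast
  then have "(\<integral>\<^sup>+ j. emeasure (S j) (A \<inter> space (S j)) \<partial>count_space D)
      = (\<Sum>j\<in>{i}. emeasure (S j) (A \<inter> space (S j)))"
    using i by (intro nn_integral_count_space') auto
  then show "emeasure (restrict_space (mixture D S) (space (S i))) A = emeasure (S i) A"
    using A by (simp add: emeasure_restrict_space[OF Si] emeasure_mixture[OF disj] Int_absorb2)
qed

lemma restrict_space_density:
  assumes "\<Omega> \<inter> space M \<in> sets M" and [measurable]: "g \<in> borel_measurable M"
  shows "restrict_space (density M g) \<Omega> = density (restrict_space M \<Omega>) g"
proof (rule measure_eqI)
  show "sets (restrict_space (density M g) \<Omega>) = sets (density (restrict_space M \<Omega>) g)"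
    by (simp add: sets_restrict_space)
  fix A assume A: "A \<in> sets (restrict_space (density M g) \<Omega>)"
  then have A': "A \<subseteq> \<Omega>" "A \<in> sets M" "A \<in> sets (restrict_space M \<Omega>)"
    using assms(1) by (auto simp: sets_restrict_space_iff)
  have "g \<in> borel_measurable (restrict_space M \<Omega>)"
    by (rule measurable_restrict_space1) simp
  then have "emeasure (density (restrict_space M \<Omega>) g) A
      = (\<integral>\<^sup>+ x. g x * indicator A x * indicator \<Omega> x \<partial>M)"
    using A' assms(1) by (simp add: emeasure_density nn_integral_restrict_space)
  also have "\<dots> = (\<integral>\<^sup>+ x. g x * indicator A x \<partial>M)"
    using A'(1) by (intro nn_integral_cong) (auto split: split_indicator)
  also have "\<dots> = emeasure (restrict_space (density M g) \<Omega>) A"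
    using A' assms(1) by (simp add: emeasure_density emeasure_restrict_space)
  finally show "emeasure (restrict_space (density M g) \<Omega>) A
      = emeasure (density (restrict_space M \<Omega>) g) A" ..
qed

section \<open>Generators of countably generated spaces\<close>

text \<open>Uniqueness of finite measures needs a pi-system, and collecting null sets needs
  countability; passing to all finite intersections of a countable generator gives both.\<close>

lemma countably_generated_measure_Int_stable:
  assumes "countably_generated_measure N"
  obtains G where "countable G" "Int_stable G" "space N \<in> G" "G \<subseteq> Pow (space N)"
    "sets N = sigma_sets (space N) G"
proof -
  obtain G where G: "countable G" "G \<subseteq> Pow (space N)" "sets N = sigma_sets (space N) G"
    using assms unfolding countably_generated_measure_def by blast
  \<comment> \<open>Intersecting with \<open>space N\<close> makes the empty family contribute
    \<open>space N\<close>, rather than the universe of the type.\<close>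
  define G' where "G' = (\<lambda>F. space N \<inter> \<Inter>F) ` {F. finite F \<and> F \<subseteq> G}"
  show thesis
  proof (rule that)
    show "countable G'"
      unfolding G'_def using G(1) by (intro countable_image countable_Collect_finite_subset)
    show "Int_stable G'"
      unfolding G'_def
    proof (rule Int_stableI_image)
      fix F F' assume "F \<in> {F. finite F \<and> F \<subseteq> G}" "F' \<in> {F. finite F \<and> F \<subseteq> G}"
      then show "\<exists>E\<in>{F. finite F \<and> F \<subseteq> G}.
          (space N \<inter> \<Inter>F) \<inter> (space N \<inter> \<Inter>F') = space N \<inter> \<Inter>E"
        by (intro bexI[of _ "F \<union> F'"]) auto
    qed
    show "space N \<in> G'"
      unfolding G'_def by (intro image_eqI[of _ _ "{}"]) auto
    show "G' \<subseteq> Pow (space N)"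
      unfolding G'_def by blast
    show "sets N = sigma_sets (space N) G'"
      unfolding G(3)
    proof (rule sigma_sets_eqI)
      fix A assume A: "A \<in> G"
      then have "A = space N \<inter> \<Inter>{A}" using G(2) by auto
      then have "A \<in> G'"
        unfolding G'_def using A by (intro image_eqI[of _ _ "{A}"]) auto
      then show "A \<in> sigma_sets (space N) G'" by blast
    next
      fix A assume "A \<in> G'"
      then obtain F where F: "finite F" "F \<subseteq> G" "A = space N \<inter> \<Inter>F"
        unfolding G'_def by blast
      have "F \<subseteq> sets N" using F(2) G(3) by (auto intro: sigma_sets.Basic)
      with F(1) have "space N \<inter> \<Inter>F \<in> sets N"
        by (induction F rule: finite_induct) (auto simp: Int_left_commute)
      then show "A \<in> sigma_sets (space N) G" using F(3) G(3) by simp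
    qed
  qed
qed

section \<open>Joint laws of states and auxiliary variables\<close>

lemma kernel_densityD:
  assumes "kernel_density E V k"
  shows "k \<in> borel_measurable (E \<Otimes>\<^sub>M V)"
    and "x \<in> space E \<Longrightarrow> v \<in> space V \<Longrightarrow> 0 \<le> k (x, v)"
    and "x \<in> space E \<Longrightarrow> (\<integral>\<^sup>+ v. ennreal (k (x, v)) \<partial>V) = 1"
  using assms unfolding kernel_density_def space_pair_measure by auto

lemma prob_space_kernel_density:
  assumes "kernel_density E V k" "x \<in> space E"
  shows "prob_space (density V (\<lambda>v. ennreal (k (x, v))))"
proof (rule prob_spaceI)
  have [measurable]: "(\<lambda>v. k (x, v)) \<in> borel_measurable V"
    using kernel_densityD(1)[OF assms(1)] assms(2) by (rule measurable_compose_Pair1[rotated])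
  show "emeasure (density V (\<lambda>v. ennreal (k (x, v)))) (space (density V (\<lambda>v. ennreal (k (x, v))))) = 1"
    using kernel_densityD(3)[OF assms]
    by (simp add: emeasure_density)
qed

text \<open>Tonelli's theorem, with the weight \<open>w x\<close> constant along each fibre. The
  image formula for kernel products and the disintegration of the joint law both rest on it.\<close>

lemma nn_integral_density_kernel_density:
  fixes w :: "'a \<Rightarrow> ennreal"
  assumes V: "sigma_finite_measure V" and k: "kernel_density E V k"
    and [measurable]: "w \<in> borel_measurable E" "g \<in> borel_measurable (E \<Otimes>\<^sub>M V)"
  shows "(\<integral>\<^sup>+ z. g z \<partial>density (E \<Otimes>\<^sub>M V) (\<lambda>z. w (fst z) * ennreal (k z)))
      = (\<integral>\<^sup>+ x. (\<integral>\<^sup>+ v. g (x, v) \<partial>density V (\<lambda>v. ennreal (k (x, v)))) \<partial>density E w)"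
proof -
  interpret V: sigma_finite_measure V by fact
  note [measurable] = kernel_densityD(1)[OF k]
  have "(\<integral>\<^sup>+ z. g z \<partial>density (E \<Otimes>\<^sub>M V) (\<lambda>z. w (fst z) * ennreal (k z)))
      = (\<integral>\<^sup>+ z. w (fst z) * ennreal (k z) * g z \<partial>(E \<Otimes>\<^sub>M V))"
    by (rule nn_integral_density) simp_all
  also have "\<dots> = (\<integral>\<^sup>+ x. (\<integral>\<^sup>+ v. w x * (ennreal (k (x, v)) * g (x, v)) \<partial>V) \<partial>E)"
    by (subst V.nn_integral_fst[symmetric]) (simp_all add: mult.assoc)
  also have "\<dots> = (\<integral>\<^sup>+ x. w x * (\<integral>\<^sup>+ v. ennreal (k (x, v)) * g (x, v) \<partial>V) \<partial>E)"
    by (intro nn_integral_cong nn_integral_cmult) simp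
  also have "\<dots> = (\<integral>\<^sup>+ x. (\<integral>\<^sup>+ v. ennreal (k (x, v)) * g (x, v) \<partial>V) \<partial>density E w)"
    by (rule nn_integral_density[symmetric]) simp_all
  also have "\<dots> = (\<integral>\<^sup>+ x. (\<integral>\<^sup>+ v. g (x, v) \<partial>density V (\<lambda>v. ennreal (k (x, v)))) \<partial>density E w)"
    by (intro nn_integral_cong nn_integral_density[symmetric]) simp_all
  finally show ?thesis .
qed

lemma emeasure_proposal:
  assumes k: "kernel_density E V k" and t: "t \<in> measurable (E \<Otimes>\<^sub>M V) N"
    and x: "x \<in> space E" and A: "A \<in> sets N"
  shows "emeasure (proposal V N k t x) A
      = (\<integral>\<^sup>+ v. ennreal (k (x, v)) * indicator A (t (x, v)) \<partial>V)"
proof -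
  note [measurable] = kernel_densityD(1)[OF k] t A x
  show ?thesis
    unfolding proposal_def
    by (subst nn_integral_indicator[symmetric], simp, subst nn_integral_distr)
       (simp_all add: nn_integral_density)
qed

lemma proposal_measurable:
  assumes V: "sigma_finite_measure V" and k: "kernel_density E V k"
    and t [measurable]: "t \<in> measurable (E \<Otimes>\<^sub>M V) N"
  shows "proposal V N k t \<in> measurable E (subprob_algebra N)"
proof (rule measurable_subprob_algebra)
  interpret V: sigma_finite_measure V by fact
  note [measurable] = kernel_densityD(1)[OF k]
  show "sets (proposal V N k t x) = sets N" for x
    by (simp add: proposal_def)
  show "subprob_space (proposal V N k t x)" if x: "x \<in> space E" for x
  proof -
    interpret prob_space "density V (\<lambda>v. ennreal (k (x, v)))"
      using k x by (rule prob_space_kernel_density)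
    have "prob_space (proposal V N k t x)"
      unfolding proposal_def using x by (intro prob_space_distr) simp
    then show ?thesis by (rule prob_space_imp_subprob_space)
  qed
  fix A assume [measurable]: "A \<in> sets N"
  have "(\<lambda>x. \<integral>\<^sup>+ v. ennreal (k (x, v)) * indicator A (t (x, v)) \<partial>V) \<in> borel_measurable E"
    by measurable
  then show "(\<lambda>x. emeasure (proposal V N k t x) A) \<in> borel_measurable E"
    by (subst measurable_cong[OF emeasure_proposal[OF k t]]) simp_all
qed

text \<open>The auxiliary variable is kept instead of being integrated out, so that the kernel gives
  way to an explicit density on the larger space. There the two directions of a move can be compared
  pointwise.\<close>

lemma kernel_prod_proposal:
  fixes w :: "'a \<Rightarrow> ennreal"
  assumes V: "sigma_finite_measure V" and k: "kernel_density E V k"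
    and t [measurable]: "t \<in> measurable (E \<Otimes>\<^sub>M V) N" and w [measurable]: "w \<in> borel_measurable E"
  shows "kernel_prod (density E w) N (proposal V N k t)
      = distr (density (E \<Otimes>\<^sub>M V) (\<lambda>z. w (fst z) * ennreal (k z))) (E \<Otimes>\<^sub>M N) (\<lambda>z. (fst z, t z))"
    (is "?L = ?R")
proof (rule measure_eqI)
  interpret V: sigma_finite_measure V by fact
  note [measurable] = kernel_densityD(1)[OF k]
  have sets_density: "sets (density E w \<Otimes>\<^sub>M N) = sets (E \<Otimes>\<^sub>M N)"
    by (intro sets_pair_measure_cong) simp_all
  show "sets ?L = sets ?R"
    by (simp add: sets_kernel_prod sets_density)
  fix A assume "A \<in> sets ?L"
  then have A [measurable]: "A \<in> sets (E \<Otimes>\<^sub>M N)"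
    by (simp add: sets_kernel_prod sets_density)
  have "emeasure ?L A = (\<integral>\<^sup>+ x. (\<integral>\<^sup>+ y. indicator A (x, y) \<partial>proposal V N k t x) \<partial>density E w)"
    using proposal_measurable[OF V k t] A
    by (intro emeasure_kernel_prod) (simp_all add: sets_density)
  also have "\<dots> = (\<integral>\<^sup>+ x. (\<integral>\<^sup>+ v. indicator A (x, t (x, v))
      \<partial>density V (\<lambda>v. ennreal (k (x, v)))) \<partial>density E w)"
    unfolding proposal_def by (intro nn_integral_cong nn_integral_distr) simp_all
  also have "\<dots> = (\<integral>\<^sup>+ z. indicator A (fst z, t z)
      \<partial>density (E \<Otimes>\<^sub>M V) (\<lambda>z. w (fst z) * ennreal (k z)))"
    by (subst nn_integral_density_kernel_density[OF V k]) simp_all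
  also have "\<dots> = emeasure ?R A"
    by (subst nn_integral_indicator[symmetric], simp, subst nn_integral_distr) simp_all
  finally show "emeasure ?L A = emeasure ?R A" .
qed

lemma kernel_prod_kernel_density:
  fixes w :: "'a \<Rightarrow> ennreal"
  assumes "sigma_finite_measure V" "kernel_density E V k" "w \<in> borel_measurable E"
  shows "kernel_prod (density E w) V (\<lambda>x. density V (\<lambda>v. ennreal (k (x, v))))
      = density (E \<Otimes>\<^sub>M V) (\<lambda>z. w (fst z) * ennreal (k z))"
proof -
  \<comment> \<open>With \<open>snd\<close> as transition map the proposal is the law of the
    auxiliary variable itself, and the image map of the general formula is the identity.\<close>
  have "proposal V V k snd = (\<lambda>x. density V (\<lambda>v. ennreal (k (x, v))))"
    unfolding proposal_def by (auto intro!: ext distr_id2)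
  then show ?thesis
    using kernel_prod_proposal[OF assms(1,2) measurable_snd assms(3)] by (simp add: distr_id2)
qed

lemma finite_measure_density_kernel_density:
  fixes w :: "'a \<Rightarrow> ennreal"
  assumes V: "sigma_finite_measure V" and k: "kernel_density E V k"
    and w [measurable]: "w \<in> borel_measurable E" and fin: "finite_measure (density E w)"
  shows "finite_measure (density (E \<Otimes>\<^sub>M V) (\<lambda>z. w (fst z) * ennreal (k z)))" (is "finite_measure ?P")
proof (rule finite_measureI)
  have one: "(\<integral>\<^sup>+ v. 1 \<partial>density V (\<lambda>v. ennreal (k (x, v)))) = 1" if "x \<in> space E" for x
    using prob_space.emeasure_space_1[OF prob_space_kernel_density[OF k that]] by simp
  have "emeasure ?P (space ?P) = (\<integral>\<^sup>+ z. 1 \<partial>?P)"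
    by simp
  also have "\<dots> = (\<integral>\<^sup>+ x. (\<integral>\<^sup>+ v. 1 \<partial>density V (\<lambda>v. ennreal (k (x, v)))) \<partial>density E w)"
    by (rule nn_integral_density_kernel_density[OF V k w]) simp
  also have "\<dots> = (\<integral>\<^sup>+ x. 1 \<partial>density E w)"
    by (rule nn_integral_cong) (simp only: space_density one)
  also have "\<dots> = emeasure (density E w) (space (density E w))"
    by simp
  finally show "emeasure ?P (space ?P) \<noteq> \<infinity>"
    using finite_measure.emeasure_finite[OF fin] by simp
qed

section \<open>Change of variables and disintegration\<close>

text \<open>Condition (II) measures images of sets, whereas \<open>distr\<close> measures preimages.
  The right inverse \<open>\<Psi>\<close> makes \<open>\<Phi>\<close> onto, so each set of
  \<open>W'\<close> is the image of its own preimage.\<close>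

lemma distr_density_of_emeasure_image:
  assumes \<Phi>: "\<Phi> \<in> measurable W W'" and [measurable]: "f \<in> borel_measurable W"
    and \<Psi>: "\<Psi> \<in> space W' \<rightarrow> space W"
    and inv: "\<And>y. y \<in> space W' \<Longrightarrow> \<Phi> (\<Psi> y) = y"
    and img: "\<And>C. C \<in> sets W \<Longrightarrow> emeasure W' (\<Phi> ` C) = (\<integral>\<^sup>+ z\<in>C. f z \<partial>W)"
  shows "distr (density W f) W' \<Phi> = W'"
proof (rule measure_eqI)
  fix B assume "B \<in> sets (distr (density W f) W' \<Phi>)"
  then have B: "B \<in> sets W'" by simp
  have C: "\<Phi> -` B \<inter> space W \<in> sets W"
    using \<Phi> B by (rule measurable_sets)
  have "\<Phi> ` (\<Phi> -` B \<inter> space W) = B"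
  proof (intro subset_antisym subsetI)
    fix y assume y: "y \<in> B"
    then have "y \<in> space W'" using sets.sets_into_space[OF B] by blast
    then show "y \<in> \<Phi> ` (\<Phi> -` B \<inter> space W)"
      using y inv \<Psi> by (intro image_eqI[of _ _ "\<Psi> y"]) auto
  qed auto
  then show "emeasure (distr (density W f) W' \<Phi>) B = emeasure W' B"
    using img[OF C] \<Phi> B C by (simp add: emeasure_distr emeasure_density)
qed simp

text \<open>Both sides of the conditional-expectation identity are finite measures in the last
  coordinate for almost every \<open>x\<close>, so it suffices to match them on a countable generator.\<close>

lemma is_cond_exp_given_disintegrate:
  fixes w :: "'a \<Rightarrow> ennreal" and X :: "'a \<times> 'b \<Rightarrow> ennreal"
  assumes V: "sigma_finite_measure V" and k: "kernel_density E V k"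
    and w [measurable]: "w \<in> borel_measurable E" and fin: "finite_measure (density E w)"
    and t [measurable]: "t \<in> measurable (E \<Otimes>\<^sub>M V) N"
    and X [measurable]: "X \<in> borel_measurable (E \<Otimes>\<^sub>M V)"
    and q [measurable]: "q \<in> borel_measurable (E \<Otimes>\<^sub>M N)"
    and N: "countably_generated_measure N"
    and X_fin: "(\<integral>\<^sup>+ z. X z \<partial>density (E \<Otimes>\<^sub>M V) (\<lambda>z. w (fst z) * ennreal (k z))) \<noteq> \<infinity>"
    and eq: "\<And>A. A \<in> sets (E \<Otimes>\<^sub>M N) \<Longrightarrow>
      (\<integral>\<^sup>+ z. X z * indicator A (fst z, t z) \<partial>density (E \<Otimes>\<^sub>M V) (\<lambda>z. w (fst z) * ennreal (k z)))
      = (\<integral>\<^sup>+ z. q (fst z, t z) * indicator A (fst z, t z)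
          \<partial>density (E \<Otimes>\<^sub>M V) (\<lambda>z. w (fst z) * ennreal (k z)))"
  shows "AE x in density E w.
      is_cond_exp_given (density V (\<lambda>v. ennreal (k (x, v)))) (\<lambda>v. X (x, v)) N (\<lambda>v. t (x, v))
        (\<lambda>y. q (x, y))"
proof -
  interpret V: sigma_finite_measure V by fact
  interpret \<mu>: finite_measure "density E w" by fact
  note k_meas [measurable] = kernel_densityD(1)[OF k]
  define \<kappa> where "\<kappa> x = density V (\<lambda>v. ennreal (k (x, v)))" for x
  have sets_\<kappa> [measurable_cong]: "sets (\<kappa> x) = sets V" for x
    by (simp add: \<kappa>_def)
  have meas_\<kappa>: "(\<lambda>x. \<integral>\<^sup>+ v. g (x, v) \<partial>\<kappa> x) \<in> borel_measurable E"
    if [measurable]: "g \<in> borel_measurable (E \<Otimes>\<^sub>M V)" for g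
  proof -
    have "(\<integral>\<^sup>+ v. g (x, v) \<partial>\<kappa> x) = (\<integral>\<^sup>+ v. ennreal (k (x, v)) * g (x, v) \<partial>V)"
      if "x \<in> space E" for x
      unfolding \<kappa>_def using that by (intro nn_integral_density) simp_all
    then show ?thesis
      by (subst measurable_cong) measurable
  qed
  note fubini = nn_integral_density_kernel_density[OF V k w, folded \<kappa>_def]
  obtain G where G: "countable G" "Int_stable G" "space N \<in> G" "G \<subseteq> Pow (space N)"
      "sets N = sigma_sets (space N) G"
    using N by (rule countably_generated_measure_Int_stable)
  \<comment> \<open>For fixed \<open>B\<close>, the rectangles \<open>A \<times> B\<close> in the
    hypothesis give both functions of \<open>x\<close> the same integral over every
    \<open>A\<close>. They therefore agree outside a null set, which may depend on
    \<open>B\<close>.\<close>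
  have "AE x in density E w. (\<integral>\<^sup>+ v. X (x, v) * indicator B (t (x, v)) \<partial>\<kappa> x)
      = (\<integral>\<^sup>+ v. q (x, t (x, v)) * indicator B (t (x, v)) \<partial>\<kappa> x)"
    if "B \<in> G" for B
  proof (rule \<mu>.density_unique2)
    have B [measurable]: "B \<in> sets N"
      using that G(5) by (simp add: sigma_sets.Basic)
    show "(\<lambda>x. \<integral>\<^sup>+ v. X (x, v) * indicator B (t (x, v)) \<partial>\<kappa> x) \<in> borel_measurable (density E w)"
      using meas_\<kappa>[of "\<lambda>z. X z * indicator B (t z)"] by simp
    show "(\<lambda>x. \<integral>\<^sup>+ v. q (x, t (x, v)) * indicator B (t (x, v)) \<partial>\<kappa> x) \<in> borel_measurable (density E w)"
      using meas_\<kappa>[of "\<lambda>z. q (fst z, t z) * indicator B (t z)"] by simp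
    fix A assume "A \<in> sets (density E w)"
    then have A [measurable]: "A \<in> sets E" by simp
    have slice: "(\<integral>\<^sup>+ z. g z * indicator (A \<times> B) (fst z, t z)
        \<partial>density (E \<Otimes>\<^sub>M V) (\<lambda>z. w (fst z) * ennreal (k z)))
      = (\<integral>\<^sup>+ x\<in>A. (\<integral>\<^sup>+ v. g (x, v) * indicator B (t (x, v)) \<partial>\<kappa> x) \<partial>density E w)"
      if [measurable]: "g \<in> borel_measurable (E \<Otimes>\<^sub>M V)" for g
    proof (subst fubini)
      show "(\<integral>\<^sup>+ x. (\<integral>\<^sup>+ v. g (x, v) * indicator (A \<times> B) (fst (x, v), t (x, v)) \<partial>\<kappa> x) \<partial>density E w)
        = (\<integral>\<^sup>+ x\<in>A. (\<integral>\<^sup>+ v. g (x, v) * indicator B (t (x, v)) \<partial>\<kappa> x) \<partial>density E w)"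
        by (intro nn_integral_cong) (auto simp: indicator_times split: split_indicator)
    qed measurable
    show "(\<integral>\<^sup>+ x\<in>A. (\<integral>\<^sup>+ v. X (x, v) * indicator B (t (x, v)) \<partial>\<kappa> x) \<partial>density E w)
      = (\<integral>\<^sup>+ x\<in>A. (\<integral>\<^sup>+ v. q (x, t (x, v)) * indicator B (t (x, v)) \<partial>\<kappa> x) \<partial>density E w)"
      using eq[of "A \<times> B"] slice[of X] slice[of "\<lambda>z. q (fst z, t z)"] by simp
  qed
  \<comment> \<open>Countability of \<open>G\<close> merges these exceptional sets into one.\<close>
  then have AE_G: "AE x in density E w. \<forall>B\<in>G. (\<integral>\<^sup>+ v. X (x, v) * indicator B (t (x, v)) \<partial>\<kappa> x)
      = (\<integral>\<^sup>+ v. q (x, t (x, v)) * indicator B (t (x, v)) \<partial>\<kappa> x)"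
    using G(1) by (simp add: AE_ball_countable)
  \<comment> \<open>Uniqueness of measures on a generator needs finite mass on
    \<open>space N\<close>, which holds for almost every \<open>x\<close> because the joint integral
    of \<open>X\<close> is finite.\<close>
  have "AE x in density E w. (\<integral>\<^sup>+ v. X (x, v) \<partial>\<kappa> x) \<noteq> \<infinity>"
    using X_fin meas_\<kappa>[OF X] by (intro nn_integral_PInf_AE) (simp_all add: fubini)
  then have "AE x in density E w.
      is_cond_exp_given (\<kappa> x) (\<lambda>v. X (x, v)) N (\<lambda>v. t (x, v)) (\<lambda>y. q (x, y))"
    using AE_G AE_space
  proof eventually_elim
    case (elim x)
    then have x [measurable]: "x \<in> space E" by simp
    have dens: "emeasure (distr (density (\<kappa> x) g) N (\<lambda>v. t (x, v))) B
        = (\<integral>\<^sup>+ v. g v * indicator B (t (x, v)) \<partial>\<kappa> x)"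
      if [measurable]: "g \<in> borel_measurable V" "B \<in> sets N" for g B
      by (subst nn_integral_indicator[symmetric], simp, subst nn_integral_distr)
         (simp_all add: nn_integral_density)
    have G_sets: "B \<in> sets N" if "B \<in> G" for B
      using that G(5) by (simp add: sigma_sets.Basic)
    \<comment> \<open>As a function of \<open>B\<close>, each side is a measure, namely the image of
      \<open>\<kappa> x\<close> reweighted by \<open>X\<close> or by \<open>q\<close>. Agreement on
      the pi-system \<open>G\<close> then extends to all of \<open>sets N\<close>.\<close>
    have "distr (density (\<kappa> x) (\<lambda>v. X (x, v))) N (\<lambda>v. t (x, v))
        = distr (density (\<kappa> x) (\<lambda>v. q (x, t (x, v)))) N (\<lambda>v. t (x, v))" (is "?L = ?R")
    proof (rule measure_eqI_generator_eq[OF G(2,4), where A = "\<lambda>_. space N"])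
      show "emeasure ?L B = emeasure ?R B" if "B \<in> G" for B
        using elim that by (simp add: dens G_sets)
      have "emeasure ?L (space N) = (\<integral>\<^sup>+ v. X (x, v) * indicator (space N) (t (x, v)) \<partial>\<kappa> x)"
        by (simp add: dens)
      also have "\<dots> \<le> (\<integral>\<^sup>+ v. X (x, v) \<partial>\<kappa> x)"
        by (intro nn_integral_mono) (auto split: split_indicator)
      finally show "emeasure ?L (space N) \<noteq> \<infinity>"
        using elim by (auto simp: top_unique)
    qed (use G in auto)
    then have "(\<integral>\<^sup>+ v. X (x, v) * indicator B (t (x, v)) \<partial>\<kappa> x)
        = (\<integral>\<^sup>+ v. q (x, t (x, v)) * indicator B (t (x, v)) \<partial>\<kappa> x)" if "B \<in> sets N" for B
      using that dens[of "\<lambda>v. X (x, v)" B] dens[of "\<lambda>v. q (x, t (x, v))" B] by simp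
    moreover have "finite_measure (\<kappa> x)"
      unfolding \<kappa>_def using prob_space_kernel_density[OF k x] by (rule prob_space.finite_measure)
    ultimately show ?case
      by (intro is_cond_exp_givenI) simp_all
  qed
  then show ?thesis
    unfolding \<kappa>_def .
qed

section \<open>The move ratio as a conditional expectation\<close>

text \<open>The quantifier over \<open>q\<close> covers every version of the density quotient.
  Conditioning appears in two forms: jointly on both states, and for almost every fixed starting
  state when the target is countably generated, so that one exceptional set serves all events. The
  assumption \<open>retrace\<close> confines backward mass at points where \<open>k l\<close>
  vanishes to a null set of the forward measure. Such mass could otherwise enter the quotient at
  pairs of states that the forward move reaches through other auxiliary values, while the ratio is
  \<open>0\<close> at those points.\<close>

theorem lemma8:
  fixes D :: "'d set" and S :: "'d \<Rightarrow> 's measure"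
    and \<pi> :: "'s measure" and p :: "'s \<Rightarrow> real"
    and M :: "'m set" and src tgt :: "'m \<Rightarrow> 'd" and rev :: "'m \<Rightarrow> 'm"
    and U :: "'m \<Rightarrow> 'u measure" and k :: "'m \<Rightarrow> 's \<times> 'u \<Rightarrow> real"
    and s :: "'m \<Rightarrow> 's \<times> 'u \<Rightarrow> 's" and u :: "'m \<Rightarrow> 's \<times> 'u \<Rightarrow> 'u"
    and f :: "'m \<Rightarrow> 's \<times> 'u \<Rightarrow> real" and l :: 'm
  defines "\<Phi> \<equiv> \<lambda>m z. (s m z, u m z)"
    and "\<pi>K \<equiv> \<lambda>m. kernel_prod (restrict_space \<pi> (space (S (src m)))) (S (tgt m))
                 (proposal (U m) (S (tgt m)) (k m) (s m))"
    and "r \<equiv> move_ratio p (k l) (k (rev l)) (\<lambda>z. (s l z, u l z)) (f l)"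
  assumes D: "countable D"
    and S: "\<And>i. i \<in> D \<Longrightarrow> sigma_finite_measure (S i)"
    and disj: "disjoint_family_on (\<lambda>i. space (S i)) D"
    and pi: "prob_space \<pi>"
    and p: "p \<in> borel_measurable (mixture D S)"
           "\<And>x. x \<in> space (mixture D S) \<Longrightarrow> 0 \<le> p x"
           "\<pi> = density (mixture D S) (\<lambda>x. ennreal (p x))"
    and M: "countable M"
    and ends: "\<And>m. m \<in> M \<Longrightarrow> src m \<in> D" "\<And>m. m \<in> M \<Longrightarrow> tgt m \<in> D"
    and rev: "\<And>m. m \<in> M \<Longrightarrow> rev m \<in> M" "\<And>m. m \<in> M \<Longrightarrow> rev (rev m) = m"
             "\<And>m. m \<in> M \<Longrightarrow> src (rev m) = tgt m" "\<And>m. m \<in> M \<Longrightarrow> tgt (rev m) = src m"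
    and U: "\<And>m. m \<in> M \<Longrightarrow> sigma_finite_measure (U m)"
    and k: "\<And>m. m \<in> M \<Longrightarrow> kernel_density (S (src m)) (U m) (k m)"
    and s: "\<And>m. m \<in> M \<Longrightarrow> s m \<in> measurable (S (src m) \<Otimes>\<^sub>M U m) (S (tgt m))"
    and u: "\<And>m. m \<in> M \<Longrightarrow> u m \<in> measurable (S (src m) \<Otimes>\<^sub>M U m) (U (rev m))"
    and f: "\<And>m. m \<in> M \<Longrightarrow> f m \<in> borel_measurable (S (src m) \<Otimes>\<^sub>M U m)"
           "\<And>m z. m \<in> M \<Longrightarrow> z \<in> space (S (src m) \<Otimes>\<^sub>M U m) \<Longrightarrow> 0 \<le> f m z"
    and I: "\<And>m z. m \<in> M \<Longrightarrow> z \<in> space (S (src m) \<Otimes>\<^sub>M U m) \<Longrightarrow> \<Phi> (rev m) (\<Phi> m z) = z"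
           "\<And>m y. m \<in> M \<Longrightarrow> y \<in> space (S (tgt m) \<Otimes>\<^sub>M U (rev m)) \<Longrightarrow> \<Phi> m (\<Phi> (rev m) y) = y"
    and II: "\<And>m C. m \<in> M \<Longrightarrow> C \<in> sets (S (src m) \<Otimes>\<^sub>M U m) \<Longrightarrow>
               emeasure (S (tgt m) \<Otimes>\<^sub>M U (rev m)) (\<Phi> m ` C)
                 = (\<integral>\<^sup>+ z\<in>C. ennreal (f m z) \<partial>(S (src m) \<Otimes>\<^sub>M U m))"
    and l: "l \<in> M"
    and retrace: "\<exists>N \<in> null_sets (\<pi>K l).
           AE y in S (tgt l) \<Otimes>\<^sub>M U (rev l).
             0 < p (fst y) * k (rev l) y \<and> k l (\<Phi> (rev l) y) = 0
               \<longrightarrow> (s (rev l) y, fst y) \<in> N"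
  shows "\<forall>q. is_density_quotient
           (distr (\<pi>K (rev l)) (S (src l) \<Otimes>\<^sub>M S (tgt l)) prod.swap) (\<pi>K l) q \<longrightarrow>
           is_cond_exp_given
             (kernel_prod (restrict_space \<pi> (space (S (src l)))) (U l)
                (\<lambda>x. density (U l) (\<lambda>v. ennreal (k l (x, v)))))
             (\<lambda>z. ennreal (r z)) (S (src l) \<Otimes>\<^sub>M S (tgt l)) (\<lambda>z. (fst z, s l z)) q \<and>
           (countably_generated_measure (S (tgt l)) \<longrightarrow>
             (AE x in restrict_space \<pi> (space (S (src l))).
                is_cond_exp_given (density (U l) (\<lambda>v. ennreal (k l (x, v))))
                  (\<lambda>v. ennreal (r (x, v))) (S (tgt l)) (\<lambda>v. s l (x, v)) (\<lambda>y. q (x, y))))"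
proof (intro allI impI)
  fix q
  assume q: "is_density_quotient
      (distr (\<pi>K (rev l)) (S (src l) \<Otimes>\<^sub>M S (tgt l)) prod.swap) (\<pi>K l) q"
  have \<pi>_restrict: "restrict_space \<pi> (space (S i)) = density (S i) (\<lambda>x. ennreal (p x))" if i: "i \<in> D" for i
  proof -
    have "space (S i) \<inter> space (mixture D S) \<in> sets (mixture D S)"
      by (rule sets.Int[OF sets_mixture_component[of i D, OF i sets.top] sets.top])
    then show ?thesis
      using p(1) unfolding p(3)
      by (subst restrict_space_density) (simp_all add: restrict_space_mixture[OF disj i])
  qed
  have finite_\<pi>: "finite_measure (density (S i) (\<lambda>x. ennreal (p x)))" if i: "i \<in> D" for i
  proof -
    have "space (S i) \<in> sets \<pi>"
      using i by (simp add: p(3) sets_mixture_component)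
    then have "finite_measure (restrict_space \<pi> (space (S i)))"
      using prob_space.finite_measure[OF pi] by (intro finite_measure_restrict_space) auto
    then show ?thesis
      by (simp add: \<pi>_restrict i)
  qed
  have p_meas: "p \<in> borel_measurable (S i)" if "i \<in> D" for i
    using measurable_mixture_component[OF disj that p(1)] .
  have p_nonneg: "0 \<le> p x" if "i \<in> D" "x \<in> space (S i)" for i x
    using p(2) that by (auto simp: space_mixture)
  have \<pi>K_eq: "\<pi>K m = distr (density (S (src m) \<Otimes>\<^sub>M U m) (\<lambda>z. ennreal (p (fst z)) * ennreal (k m z)))
      (S (src m) \<Otimes>\<^sub>M S (tgt m)) (\<lambda>z. (fst z, s m z))" if m: "m \<in> M" for m
    unfolding \<pi>K_def \<pi>_restrict[OF ends(1)[OF m]]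
    using U[OF m] k[OF m] s[OF m] p_meas[OF ends(1)[OF m]] by (intro kernel_prod_proposal) simp_all

  let ?E = "S (src l)" and ?N = "S (tgt l)" and ?V = "U l" and ?V' = "U (rev l)"
  let ?W = "?E \<Otimes>\<^sub>M ?V" and ?W' = "?N \<Otimes>\<^sub>M ?V'"
  let ?T = "\<lambda>z. (fst z, s l z)"
  define a where "a z = ennreal (p (fst z)) * ennreal (k l z)" for z
  define b where "b y = ennreal (p (fst y)) * ennreal (k (rev l) y)" for y
  \<comment> \<open>Here \<open>b\<close> is the backward joint density in its own coordinates, and
    \<open>f l\<close> is the Jacobian factor from (II) that transports it to the forward
    coordinates.\<close>
  define c where "c z = ennreal (f l z) * b (\<Phi> l z)" for z
  note l' = rev(1)[OF l]
  have [measurable]: "p \<in> borel_measurable ?E" "p \<in> borel_measurable ?N"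
    using p_meas ends[OF l] by auto
  have [measurable]: "k l \<in> borel_measurable ?W" "k (rev l) \<in> borel_measurable ?W'"
    using kernel_densityD(1)[OF k[OF l]] kernel_densityD(1)[OF k[OF l']] rev(3)[OF l] by auto
  have [measurable]: "s l \<in> measurable ?W ?N" "u l \<in> measurable ?W ?V'" "f l \<in> borel_measurable ?W"
    using s[OF l] u[OF l] f(1)[OF l] by auto
  have [measurable]: "s (rev l) \<in> measurable ?W' ?E" "u (rev l) \<in> measurable ?W' ?V"
    using s[OF l'] u[OF l'] rev[OF l] by auto
  have \<Phi>_meas [measurable]: "\<Phi> l \<in> measurable ?W ?W'" "\<Phi> (rev l) \<in> measurable ?W' ?W"
    unfolding \<Phi>_def by measurable
  have [measurable]: "a \<in> borel_measurable ?W" "b \<in> borel_measurable ?W'"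
    unfolding a_def b_def by measurable
  have [measurable]: "c \<in> borel_measurable ?W"
    unfolding c_def by measurable

  have [measurable]: "prod.swap \<in> measurable (?N \<Otimes>\<^sub>M ?E) (?E \<Otimes>\<^sub>M ?N)"
    unfolding prod.swap_def by measurable

  \<comment> \<open>Condition (II) becomes a pushforward formula for the backward base measure,
    along which both densities and almost-everywhere statements on \<open>?W'\<close> can be pulled
    back to \<open>?W\<close>.\<close>
  have W'_eq: "distr (density ?W (\<lambda>z. ennreal (f l z))) ?W' (\<Phi> l) = ?W'"
  proof (rule distr_density_of_emeasure_image)
    show "\<Phi> (rev l) \<in> space ?W' \<rightarrow> space ?W"
      using \<Phi>_meas(2) by (rule measurable_space[THEN Pi_I])
  qed (use \<Phi>_meas(1) I(2)[OF l] II[OF l] in simp_all)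
  have swap_eq: "distr (\<pi>K (rev l)) (?E \<Otimes>\<^sub>M ?N) prod.swap = distr (density ?W c) (?E \<Otimes>\<^sub>M ?N) ?T"
  proof -
    have "distr (\<pi>K (rev l)) (?E \<Otimes>\<^sub>M ?N) prod.swap
        = distr (density ?W' b) (?E \<Otimes>\<^sub>M ?N) (\<lambda>y. (s (rev l) y, fst y))"
      unfolding \<pi>K_eq[OF l'] rev(3,4)[OF l] b_def[symmetric]
      by (subst distr_distr) (simp_all add: comp_def)
    also have "density ?W' b = distr (density ?W c) ?W' (\<Phi> l)"
    proof -
      have "density ?W' b = density (distr (density ?W (\<lambda>z. ennreal (f l z))) ?W' (\<Phi> l)) b"
        by (simp only: W'_eq)
      also have "\<dots> = distr (density (density ?W (\<lambda>z. ennreal (f l z))) (\<lambda>z. b (\<Phi> l z))) ?W' (\<Phi> l)"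
        by (rule density_distr) simp_all
      also have "\<dots> = distr (density ?W c) ?W' (\<Phi> l)"
        by (subst density_density_eq) (simp_all add: c_def[abs_def])
      finally show ?thesis .
    qed
    also have "distr (distr (density ?W c) ?W' (\<Phi> l)) (?E \<Otimes>\<^sub>M ?N) (\<lambda>y. (s (rev l) y, fst y))
        = distr (density ?W c) (?E \<Otimes>\<^sub>M ?N) (\<lambda>z. (s (rev l) (\<Phi> l z), fst (\<Phi> l z)))"
      by (subst distr_distr) (simp_all add: comp_def)
    \<comment> \<open>By (I) the backward transition from \<open>\<Phi> l z\<close> returns to
      \<open>fst z\<close>, so the swapped backward pair is the forward pair
      \<open>?T z\<close>.\<close>
    also have "\<dots> = distr (density ?W c) (?E \<Otimes>\<^sub>M ?N) ?T"
    proof (rule distr_cong)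
      fix z assume "z \<in> space (density ?W c)"
      then have "\<Phi> (rev l) (\<Phi> l z) = z"
        using I(1)[OF l] by simp
      then have "s (rev l) (\<Phi> l z) = fst z"
        unfolding \<Phi>_def by (metis fst_conv)
      then show "(s (rev l) (\<Phi> l z), fst (\<Phi> l z)) = (fst z, s l z)"
        by (simp add: \<Phi>_def)
    qed simp_all
    finally show ?thesis .
  qed
  have \<pi>K_l: "\<pi>K l = distr (density ?W a) (?E \<Otimes>\<^sub>M ?N) ?T"
    using \<pi>K_eq[OF l] by (simp add: a_def[abs_def])

  have finite_a: "finite_measure (density ?W a)"
    unfolding a_def[abs_def] using U[OF l] k[OF l] finite_\<pi>[OF ends(1)[OF l]]
    by (intro finite_measure_density_kernel_density) simp_all
  then have finite_Q: "finite_measure (distr (density ?W a) (?E \<Otimes>\<^sub>M ?N) ?T)"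
    by (intro finite_measure.finite_measure_distr) simp_all
  have "finite_measure (density ?W' b)"
    unfolding b_def[abs_def] using U[OF l'] k[OF l'] finite_\<pi>[OF ends(2)[OF l]] rev(3)[OF l]
    by (intro finite_measure_density_kernel_density) simp_all
  then have "finite_measure (\<pi>K (rev l))"
    unfolding \<pi>K_eq[OF l'] rev(3,4)[OF l] b_def[symmetric]
    by (intro finite_measure.finite_measure_distr) simp_all
  then have finite_P: "finite_measure (distr (density ?W c) (?E \<Otimes>\<^sub>M ?N) ?T)"
    unfolding swap_eq[symmetric]
    by (rule finite_measure.finite_measure_distr)
       (simp add: \<pi>K_eq[OF l'] rev(3,4)[OF l])

  obtain Z0 where Z0: "Z0 \<in> null_sets (\<pi>K l)"
    and AE_Z0: "AE y in ?W'. 0 < p (fst y) * k (rev l) y \<and> k l (\<Phi> (rev l) y) = 0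
      \<longrightarrow> (s (rev l) y, fst y) \<in> Z0"
    using retrace by blast
  \<comment> \<open>The density \<open>a\<close> vanishes where \<open>k l\<close> does, which
    \<open>retrace\<close> handles through \<open>Z0\<close>, and also where \<open>p\<close> does.
    The latter points have no forward mass, so adding all pairs that start there keeps the set
    null.\<close>
  define Z where "Z = Z0 \<union> {x \<in> space ?E. p x = 0} \<times> space ?N"
  have "{x \<in> space ?E. p x = 0} \<times> space ?N \<in> null_sets (\<pi>K l)"
  proof (rule null_setsI)
    show A [measurable]: "{x \<in> space ?E. p x = 0} \<times> space ?N \<in> sets (\<pi>K l)"
      by (simp add: \<pi>K_l)
    have "AE z in ?W. a z * indicator ({x \<in> space ?E. p x = 0} \<times> space ?N) (?T z) = 0"
      by (intro AE_I2) (auto simp: a_def split: split_indicator)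
    then show "emeasure (\<pi>K l) ({x \<in> space ?E. p x = 0} \<times> space ?N) = 0"
      unfolding \<pi>K_l
      by (subst nn_integral_indicator[symmetric], simp, subst nn_integral_distr)
         (simp_all add: nn_integral_density nn_integral_0_iff_AE)
  qed
  with Z0 have Z: "Z \<in> null_sets (distr (density ?W a) (?E \<Otimes>\<^sub>M ?N) ?T)"
    unfolding Z_def \<pi>K_l[symmetric] by (rule null_sets.Un)
  have f_meas: "(\<lambda>z. ennreal (f l z)) \<in> borel_measurable ?W"
    by simp
  have \<Phi>_dens: "\<Phi> l \<in> measurable (density ?W (\<lambda>z. ennreal (f l z))) ?W'"
    by simp
  \<comment> \<open>The assumption \<open>retrace\<close> is stated in backward coordinates. Pulled
    back along \<open>\<Phi> l\<close> it holds almost everywhere on \<open>f l > 0\<close>, which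
    contains the set where \<open>c\<close> is positive.\<close>
  have AE_Z0': "AE y in distr (density ?W (\<lambda>z. ennreal (f l z))) ?W' (\<Phi> l).
      0 < p (fst y) * k (rev l) y \<and> k l (\<Phi> (rev l) y) = 0 \<longrightarrow> (s (rev l) y, fst y) \<in> Z0"
    unfolding W'_eq by (rule AE_Z0)
  have "AE z in ?W. 0 < ennreal (f l z) \<longrightarrow>
      (0 < p (fst (\<Phi> l z)) * k (rev l) (\<Phi> l z) \<and> k l (\<Phi> (rev l) (\<Phi> l z)) = 0
      \<longrightarrow> (s (rev l) (\<Phi> l z), fst (\<Phi> l z)) \<in> Z0)"
    using AE_distrD[OF \<Phi>_dens AE_Z0'] unfolding AE_density[OF f_meas] .
  then have sing: "AE z in ?W. 0 < c z \<and> a z = 0 \<longrightarrow> ?T z \<in> Z"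
    using AE_space
  proof eventually_elim
    case (elim z)
    have z: "fst z \<in> space ?E" "s l z \<in> space ?N"
      using measurable_space[OF measurable_fst elim(2)] measurable_space[OF s[OF l] elim(2)] by auto
    have inv: "\<Phi> (rev l) (\<Phi> l z) = z"
      using I(1)[OF l elim(2)] .
    then have "s (rev l) (\<Phi> l z) = fst z"
      unfolding \<Phi>_def by (metis fst_conv)
    moreover have "fst (\<Phi> l z) = s l z"
      by (simp add: \<Phi>_def)
    \<comment> \<open>Since \<open>ennreal\<close> truncates negative values to \<open>0\<close>,
      nonnegativity of both factors is what turns \<open>a z = 0\<close> into the vanishing of
      \<open>p\<close> or \<open>k l\<close>.\<close>
    moreover have "k l z \<le> 0 \<longleftrightarrow> k l z = 0" "p (fst z) \<le> 0 \<longleftrightarrow> p (fst z) = 0"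
      using p_nonneg[OF ends(1)[OF l] z(1)] k[OF l] elim(2) unfolding kernel_density_def by fastforce+
    ultimately show ?case
      using elim(1) z inv
      by (auto simp: Z_def a_def b_def c_def ennreal_eq_0_iff ennreal_zero_less_mult_iff)
  qed

  \<comment> \<open>Where the denominator of \<open>r\<close> vanishes, so does \<open>a\<close>,
    and division by zero gives the value \<open>0\<close>. Elsewhere the denominator cancels and
    leaves \<open>c\<close>.\<close>
  have a_r: "a z * ennreal (r z) = (if a z = 0 then 0 else c z)" if z: "z \<in> space ?W" for z
  proof -
    have sp: "fst z \<in> space ?E" "fst (\<Phi> l z) \<in> space ?N" "\<Phi> l z \<in> space ?W'"
      using z measurable_space[OF \<Phi>_meas(1) z] by (auto simp: space_pair_measure)
    have nn: "0 \<le> p (fst z)" "0 \<le> k l z" "0 \<le> f l z" "0 \<le> p (fst (\<Phi> l z))" "0 \<le> k (rev l) (\<Phi> l z)"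
      using p_nonneg[OF ends(1)[OF l] sp(1)] p_nonneg[OF ends(2)[OF l] sp(2)] f(2)[OF l z]
        k[OF l] k[OF l'] z sp(3) rev(3)[OF l] unfolding kernel_density_def by auto
    have r_eq: "r z = p (fst (\<Phi> l z)) * k (rev l) (\<Phi> l z) / (p (fst z) * k l z) * f l z"
      by (simp add: r_def move_ratio_def \<Phi>_def)
    have "0 \<le> r z"
      using nn by (simp add: r_eq)
    have "a z * ennreal (r z) = ennreal ((p (fst z) * k l z) * r z)"
      using nn \<open>0 \<le> r z\<close> by (simp add: a_def ennreal_mult)
    also have "(p (fst z) * k l z) * r z
        = (if p (fst z) * k l z = 0 then 0 else f l z * (p (fst (\<Phi> l z)) * k (rev l) (\<Phi> l z)))"
      by (simp add: r_eq)
    also have "ennreal \<dots> = (if a z = 0 then 0 else c z)"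
      using nn by (auto simp: a_def b_def c_def ennreal_mult)
    finally show ?thesis .
  qed

  have q_meas [measurable]: "q \<in> borel_measurable (?E \<Otimes>\<^sub>M ?N)"
    using density_quotient_carrier[OF q[unfolded swap_eq \<pi>K_l] finite_P finite_Q] by auto
  have r_meas [measurable]: "r \<in> borel_measurable ?W"
    unfolding r_def move_ratio_def by measurable
  \<comment> \<open>Both sides equal the integral of \<open>c\<close> over the part of
    \<open>a > 0\<close> that \<open>?T\<close> maps into \<open>A\<close>: the left one by the
    cancellation \<open>a_r\<close>, the right one by the behaviour of the density quotient under
    \<open>?T\<close>.\<close>
  have cond: "(\<integral>\<^sup>+ z. ennreal (r z) * indicator A (?T z) \<partial>density ?W a)
      = (\<integral>\<^sup>+ z. q (?T z) * indicator A (?T z) \<partial>density ?W a)"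
    if A [measurable]: "A \<in> sets (?E \<Otimes>\<^sub>M ?N)" for A
  proof -
    have "(\<integral>\<^sup>+ z. ennreal (r z) * indicator A (?T z) \<partial>density ?W a)
        = (\<integral>\<^sup>+ z. a z * ennreal (r z) * indicator A (?T z) \<partial>?W)"
      by (simp add: nn_integral_density mult.assoc)
    also have "\<dots> = (\<integral>\<^sup>+ z. (if a z = 0 then 0 else c z) * indicator A (?T z) \<partial>?W)"
      by (intro nn_integral_cong) (simp only: a_r)
    also have "\<dots> = (\<integral>\<^sup>+ z. a z * (q (?T z) * indicator A (?T z)) \<partial>?W)"
      by (rule nn_integral_density_quotient_distr[symmetric, OF _ _ _
            q[unfolded swap_eq \<pi>K_l] finite_P finite_Q Z sing A]) simp_all
    also have "\<dots> = (\<integral>\<^sup>+ z. q (?T z) * indicator A (?T z) \<partial>density ?W a)"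
      by (simp add: nn_integral_density)
    finally show ?thesis .
  qed

  \<comment> \<open>The fibrewise statement needs an integrable ratio. Its integral is the mass of
    \<open>c\<close> where \<open>a\<close> is positive, hence at most the total mass of the
    backward measure, which is finite.\<close>
  have "(\<integral>\<^sup>+ z. ennreal (r z) \<partial>density ?W a) = (\<integral>\<^sup>+ z. a z * ennreal (r z) \<partial>?W)"
    by (simp add: nn_integral_density)
  also have "\<dots> \<le> (\<integral>\<^sup>+ z. c z \<partial>?W)"
    by (intro nn_integral_mono) (simp add: a_r)
  also have "\<dots> = (\<integral>\<^sup>+ y. 1 \<partial>distr (density ?W c) (?E \<Otimes>\<^sub>M ?N) ?T)"
    by (subst nn_integral_distr) (simp_all add: nn_integral_density del: nn_integral_const)
  also have "\<dots> = emeasure (distr (density ?W c) (?E \<Otimes>\<^sub>M ?N) ?T) (space (?E \<Otimes>\<^sub>M ?N))"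
    by simp
  also have "\<dots> < \<infinity>"
    using finite_measure.emeasure_finite[OF finite_P] by (simp add: less_top)
  finally have r_fin: "(\<integral>\<^sup>+ z. ennreal (r z) \<partial>density ?W a) \<noteq> \<infinity>"
    by simp

  \<comment> \<open>The law of state and auxiliary variable in the conclusion is the measure for
    which \<open>cond\<close> was shown.\<close>
  have joint: "kernel_prod (restrict_space \<pi> (space ?E)) ?V (\<lambda>x. density ?V (\<lambda>v. ennreal (k l (x, v))))
      = density ?W a"
    unfolding \<pi>_restrict[OF ends(1)[OF l]] a_def[abs_def]
    using U[OF l] k[OF l] by (intro kernel_prod_kernel_density) simp_all
  have "is_cond_exp_given (density ?W a) (\<lambda>z. ennreal (r z)) (?E \<Otimes>\<^sub>M ?N) ?T q"
    using finite_a cond by (intro is_cond_exp_givenI) simp_all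
  moreover have "AE x in restrict_space \<pi> (space ?E).
      is_cond_exp_given (density ?V (\<lambda>v. ennreal (k l (x, v))))
        (\<lambda>v. ennreal (r (x, v))) ?N (\<lambda>v. s l (x, v)) (\<lambda>y. q (x, y))"
    if "countably_generated_measure ?N"
    unfolding \<pi>_restrict[OF ends(1)[OF l]]
    using U[OF l] k[OF l] finite_\<pi>[OF ends(1)[OF l]] that r_fin cond
    by (intro is_cond_exp_given_disintegrate) (simp_all add: a_def[abs_def])
  ultimately show "is_cond_exp_given
      (kernel_prod (restrict_space \<pi> (space ?E)) ?V (\<lambda>x. density ?V (\<lambda>v. ennreal (k l (x, v)))))
      (\<lambda>z. ennreal (r z)) (?E \<Otimes>\<^sub>M ?N) ?T q \<and>
    (countably_generated_measure ?N \<longrightarrow>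
      (AE x in restrict_space \<pi> (space ?E).
        is_cond_exp_given (density ?V (\<lambda>v. ennreal (k l (x, v))))
          (\<lambda>v. ennreal (r (x, v))) ?N (\<lambda>v. s l (x, v)) (\<lambda>y. q (x, y))))"
    unfolding joint by blast
qed

end
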